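(* Let $\widehat{\mathfrak F}$, $\mathfrak F$, $\mathfrak F_\pm$, $\mathfrak F_*$, $\widetilde{\mathfrak F}$ be the families of maps of $[-1,1]$ defined in the context. Let $f\in\mathfrak F_*$. If $g\in\widetilde{\mathfrak F}$ is such that $$\overline{\operatorname{supp}(f-g)}\subset(-1,0)\cup(0,1),$$ then $g\in\mathfrak F_*$. The same statement is true if $\mathfrak F_*$ is replaced (in both places) by either of the other two subclasses $\mathfrak F$, $\mathfrak F_\pm$.
   Context: Let $I=[-1,1]$, $I_-=[-1,0]$, $I_+=[0,1]$. The class $\widehat{\mathfrak F}$ consists of all $g:I\to I$ satisfying (A0), (A1), (A2): (A0) The restrictions $g_-:(-1,0)\to(-1,1)$ and $g_+:(0,1)\to(-1,1)$ are orientation preserving $C^2$ diffeomorphisms, and the only fixed points of $g$ are $\pm1$. (Each branch is extended by continuity to the endpoints of its interval, so the one-sided values at $0$ are $g(0^-)=1$, $g(0^+)=-1$; the value assigned at the single point $0$ is immaterial.) For $\iota>0$ let $U_{0-}=(-\iota,0]$, $U_{0+}=[0,\iota)$, $U_{-1}=g(U_{0+})$, $U_{+1}=g(U_{0-})$ (images under the corresponding extended branch). (A1) There are constants $\ell_1,\ell_2\ge0$ and $\iota,k_1,k_2,a_1,a_2,b_1,b_2>0$ such that: - on $U_{-1}$: if $\ell_1>0$, $g(x)=x+b_1(1+x)^{1+\ell_1}$; if $\ell_1=0$, $g(x)=-1+(1+b_1)(x+1)+\eta(x)$ with $\eta\in C^2$, $\eta(-1)=\eta'(-1)=0$ and $\eta''>0$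 on $U_{-1}$; - on $U_{0-}$: if $k_1\ne1$, $g(x)=1-a_1|x|^{k_1}$; if $k_1=1$, $g'(0_-)=a_1>1$ and $g$ is monotone on $U_{0-}$; - on $U_{0+}$: if $k_2\neq1$, $g(x)=-1+a_2x^{k_2}$; if $k_2=1$, $g'(0_+)=a_2>1$ and $g$ is monotone on $U_{0+}$; - on $U_{+1}$: if $\ell_2>0$, $g(x)=x-b_2(1-x)^{1+\ell_2}$; if $\ell_2=0$, $g(x)=1+(1+b_2)(x-1)+\eta(x)$ with $\eta\in C^2$, $\eta(1)=\eta'(1)=0$ and $\eta''<0$ on $U_{+1}$. Let $\Delta_0^-=g^{-1}((0,1))\cap I_-$, $\Delta_0^+=g^{-1}((-1,0))\cap I_+$; for $n\ge1$, $\Delta_n^\pm=g^{-1}(\Delta_{n-1}^\pm)\cap I_\pm$, $\delta_n^-=g^{-1}(\Delta_{n-1}^+)\cap\Delta_0^-$, $\delta_n^+=g^{-1}(\Delta_{n-1}^-)\cap\Delta_0^+$. Put $n_\pm=0$ if $\Delta_0^\pm\subseteq U_{0\pm}$, and otherwise $n_\pm=\min\{n:\delta_n^\pm\subset U_{0\pm}\}$. (A2) There is $\lambda>1$ such that $(g^n)'(x)>\lambda$ for all $1\le n\le n_\pm$ and all $x\in\delta_n^\pm$ (for each choice of sign). For $g\in\widehat{\mathfrak F}$ let $\beta^-=\ell_1k_2$, $\beta^+=\ell_2k_1$, $\beta=\max\{\beta^+,\beta^-\}$. Define $\mathfrak F=\{g:\beta\in[0,1)\}$, $\mathfrak F_\pm=\{g:\beta\ge1,\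 \beta^-\ne\beta^+\}$, $\mathfrak F_*=\{g:\beta\ge1,\ \beta^-=\beta^+\}$. $\widetilde{\mathfrak F}=\{f\in\widehat{\mathfrak F}:$ both fixed points $\pm1$ are neutral$\}$, where a fixed point is neutral if the (one-sided) derivative there equals $1$; for $-1$ this means $\ell_1>0$ and for $+1$ it means $\ell_2>0$. For a function $h$, $\operatorname{supp}h=\{x:h(x)\neq0\}$. The difference $f-g$ is given the value $0$ at $0$ (both its one-sided limits there are $0$). *)

theory Defs
  imports "HOL-Analysis.Analysis"
begin

text \<open>
  Maps of \<open>I = [-1,1]\<close> are represented by functions \<open>g :: real \<Rightarrow> real\<close>; only the values on
  \<open>{-1..1} - {0}\<close> matter. The two branches carry their continuous extensions to \<open>0\<close>.
\<close>

definition branch_minus :: "(real \<Rightarrow> real) \<Rightarrow> real \<Rightarrow> real" where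
  "branch_minus g x = (if x = 0 then 1 else g x)"

definition branch_plus :: "(real \<Rightarrow> real) \<Rightarrow> real \<Rightarrow> real" where
  "branch_plus g x = (if x = 0 then -1 else g x)"

text \<open>Derivatives are taken within \<open>S\<close>, so they are one-sided at endpoints belonging to \<open>S\<close>.\<close>

definition has_C2_derivs ::
    "(real \<Rightarrow> real) \<Rightarrow> (real \<Rightarrow> real) \<Rightarrow> (real \<Rightarrow> real) \<Rightarrow> real set \<Rightarrow> bool" where
  "has_C2_derivs f f' f'' S \<longleftrightarrow>
     (\<forall>x\<in>S. (f has_real_derivative f' x) (at x within S)) \<and>
     (\<forall>x\<in>S. (f' has_real_derivative f'' x) (at x within S)) \<and>
     continuous_on S f''"

definition C2_on :: "(real \<Rightarrow> real) \<Rightarrow> real set \<Rightarrow> bool" where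
  "C2_on f S \<longleftrightarrow> (\<exists>f' f''. has_C2_derivs f f' f'' S)"

definition orientation_preserving_C2_diffeo ::
    "(real \<Rightarrow> real) \<Rightarrow> real set \<Rightarrow> real set \<Rightarrow> bool" where
  "orientation_preserving_C2_diffeo f A B \<longleftrightarrow>
     bij_betw f A B \<and> C2_on f A \<and> C2_on (the_inv_into A f) B \<and> (\<forall>x\<in>A. 0 < deriv f x)"

text \<open>
  The point \<open>0\<close> is left out of the fixed point condition since the value of \<open>g\<close> there is immaterial.
\<close>

definition A0 :: "(real \<Rightarrow> real) \<Rightarrow> bool" where
  "A0 g \<longleftrightarrow>
     orientation_preserving_C2_diffeo g {-1<..<0} {-1<..<1} \<and>
     orientation_preserving_C2_diffeo g {0<..<1} {-1<..<1} \<and>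
     {x \<in> {-1..1} - {0}. g x = x} = {-1, 1}"

definition U0_minus :: "real \<Rightarrow> real set" where
  "U0_minus \<iota> = {-\<iota><..0}"

definition U0_plus :: "real \<Rightarrow> real set" where
  "U0_plus \<iota> = {0..<\<iota>}"

definition U_neg1 :: "(real \<Rightarrow> real) \<Rightarrow> real \<Rightarrow> real set" where
  "U_neg1 g \<iota> = branch_plus g ` U0_plus \<iota>"

definition U_pos1 :: "(real \<Rightarrow> real) \<Rightarrow> real \<Rightarrow> real set" where
  "U_pos1 g \<iota> = branch_minus g ` U0_minus \<iota>"

text \<open>The bound \<open>\<iota> \<le> 1\<close> expresses that the neighbourhoods of \<open>0\<close> lie in the domain \<open>I\<close>.\<close>

definition A1 :: "(real \<Rightarrow> real) \<Rightarrow> real \<Rightarrow> real \<Rightarrow> real \<Rightarrow> real \<Rightarrow> real \<Rightarrow>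
    real \<Rightarrow> real \<Rightarrow> real \<Rightarrow> real \<Rightarrow> bool" where
  "A1 g l\<^sub>1 l\<^sub>2 \<iota> k\<^sub>1 k\<^sub>2 a\<^sub>1 a\<^sub>2 b\<^sub>1 b\<^sub>2 \<longleftrightarrow>
     0 \<le> l\<^sub>1 \<and> 0 \<le> l\<^sub>2 \<and> 0 < \<iota> \<and> \<iota> \<le> 1 \<and> 0 < k\<^sub>1 \<and> 0 < k\<^sub>2 \<and>
     0 < a\<^sub>1 \<and> 0 < a\<^sub>2 \<and> 0 < b\<^sub>1 \<and> 0 < b\<^sub>2 \<and>
     (if l\<^sub>1 > 0 then \<forall>x\<in>U_neg1 g \<iota>. g x = x + b\<^sub>1 * (1 + x) powr (1 + l\<^sub>1)
      else \<exists>\<eta> \<eta>' \<eta>''. has_C2_derivs \<eta> \<eta>' \<eta>'' (U_neg1 g \<iota>) \<and> \<eta> (-1) = 0 \<and> \<eta>' (-1) = 0 \<and>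
             (\<forall>x\<in>U_neg1 g \<iota>. \<eta>'' x > 0 \<and> g x = -1 + (1 + b\<^sub>1) * (x + 1) + \<eta> x)) \<and>
     (if k\<^sub>1 \<noteq> 1 then \<forall>x\<in>U0_minus \<iota>. branch_minus g x = 1 - a\<^sub>1 * \<bar>x\<bar> powr k\<^sub>1
      else (branch_minus g has_real_derivative a\<^sub>1) (at_left 0) \<and> a\<^sub>1 > 1 \<and>
             mono_on (U0_minus \<iota>) (branch_minus g)) \<and>
     (if k\<^sub>2 \<noteq> 1 then \<forall>x\<in>U0_plus \<iota>. branch_plus g x = -1 + a\<^sub>2 * x powr k\<^sub>2
      else (branch_plus g has_real_derivative a\<^sub>2) (at_right 0) \<and> a\<^sub>2 > 1 \<and>
             mono_on (U0_plus \<iota>) (branch_plus g)) \<and>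
     (if l\<^sub>2 > 0 then \<forall>x\<in>U_pos1 g \<iota>. g x = x - b\<^sub>2 * (1 - x) powr (1 + l\<^sub>2)
      else \<exists>\<eta> \<eta>' \<eta>''. has_C2_derivs \<eta> \<eta>' \<eta>'' (U_pos1 g \<iota>) \<and> \<eta> 1 = 0 \<and> \<eta>' 1 = 0 \<and>
             (\<forall>x\<in>U_pos1 g \<iota>. \<eta>'' x < 0 \<and> g x = 1 + (1 + b\<^sub>2) * (x - 1) + \<eta> x))"

primrec Delta_minus :: "(real \<Rightarrow> real) \<Rightarrow> nat \<Rightarrow> real set" where
  "Delta_minus g 0 = {x \<in> {-1..0}. branch_minus g x \<in> {0<..<1}}"
| "Delta_minus g (Suc n) = {x \<in> {-1..0}. branch_minus g x \<in> Delta_minus g n}"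

primrec Delta_plus :: "(real \<Rightarrow> real) \<Rightarrow> nat \<Rightarrow> real set" where
  "Delta_plus g 0 = {x \<in> {0..1}. branch_plus g x \<in> {-1<..<0}}"
| "Delta_plus g (Suc n) = {x \<in> {0..1}. branch_plus g x \<in> Delta_plus g n}"

text \<open>The sets \<open>\<delta>\<^sub>n\<close> are meant, and used, for \<open>n \<ge> 1\<close> only.\<close>

definition delta_minus :: "(real \<Rightarrow> real) \<Rightarrow> nat \<Rightarrow> real set" where
  "delta_minus g n = {x \<in> Delta_minus g 0. branch_minus g x \<in> Delta_plus g (n - 1)}"

definition delta_plus :: "(real \<Rightarrow> real) \<Rightarrow> nat \<Rightarrow> real set" where
  "delta_plus g n = {x \<in> Delta_plus g 0. branch_plus g x \<in> Delta_minus g (n - 1)}"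

definition n_minus :: "(real \<Rightarrow> real) \<Rightarrow> real \<Rightarrow> nat" where
  "n_minus g \<iota> = (if Delta_minus g 0 \<subseteq> U0_minus \<iota> then 0
                  else (LEAST n. 1 \<le> n \<and> delta_minus g n \<subseteq> U0_minus \<iota>))"

definition n_plus :: "(real \<Rightarrow> real) \<Rightarrow> real \<Rightarrow> nat" where
  "n_plus g \<iota> = (if Delta_plus g 0 \<subseteq> U0_plus \<iota> then 0
                 else (LEAST n. 1 \<le> n \<and> delta_plus g n \<subseteq> U0_plus \<iota>))"

text \<open>
  The sets \<open>\<delta>\<^sub>n\<close> are open and the points \<open>x, g x, ..., (g ^^ n) x\<close> with \<open>x\<close> in
  \<open>\<delta>\<^sub>n\<close> all lie in \<open>{-1<..<1} - {0}\<close>, so \<open>deriv\<close> (two-sided) is the intended derivative.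
\<close>

definition A2 :: "(real \<Rightarrow> real) \<Rightarrow> real \<Rightarrow> bool" where
  "A2 g \<iota> \<longleftrightarrow> (\<exists>\<Lambda>>1.
     (\<forall>n\<in>{1..n_minus g \<iota>}. \<forall>x\<in>delta_minus g n. deriv (g ^^ n) x > \<Lambda>) \<and>
     (\<forall>n\<in>{1..n_plus g \<iota>}. \<forall>x\<in>delta_plus g n. deriv (g ^^ n) x > \<Lambda>))"

text \<open>
  The exponents are determined by \<open>g\<close>: they can be read off from its germs at \<open>-1\<close>, \<open>0-\<close>, \<open>0+\<close>
  and \<open>1\<close>. Quantifying them existentially in the subclasses below is therefore the same as speaking
  of the exponents of \<open>g\<close>.
\<close>

definition FF_hat_exponents ::
    "(real \<Rightarrow> real) \<Rightarrow> real \<Rightarrow> real \<Rightarrow> real \<Rightarrow> real \<Rightarrow> bool" where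
  "FF_hat_exponents g l\<^sub>1 l\<^sub>2 k\<^sub>1 k\<^sub>2 \<longleftrightarrow>
     g ` {-1..1} \<subseteq> {-1..1} \<and> A0 g \<and>
     (\<exists>\<iota> a\<^sub>1 a\<^sub>2 b\<^sub>1 b\<^sub>2. A1 g l\<^sub>1 l\<^sub>2 \<iota> k\<^sub>1 k\<^sub>2 a\<^sub>1 a\<^sub>2 b\<^sub>1 b\<^sub>2 \<and> A2 g \<iota>)"

definition FF_hat :: "(real \<Rightarrow> real) set" where
  "FF_hat = {g. \<exists>l\<^sub>1 l\<^sub>2 k\<^sub>1 k\<^sub>2. FF_hat_exponents g l\<^sub>1 l\<^sub>2 k\<^sub>1 k\<^sub>2}"

definition has_betas :: "(real \<Rightarrow> real) \<Rightarrow> real \<Rightarrow> real \<Rightarrow> bool" where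
  "has_betas g \<beta>m \<beta>p \<longleftrightarrow>
     (\<exists>l\<^sub>1 l\<^sub>2 k\<^sub>1 k\<^sub>2. FF_hat_exponents g l\<^sub>1 l\<^sub>2 k\<^sub>1 k\<^sub>2 \<and> \<beta>m = l\<^sub>1 * k\<^sub>2 \<and> \<beta>p = l\<^sub>2 * k\<^sub>1)"

definition FF :: "(real \<Rightarrow> real) set" where
  "FF = {g \<in> FF_hat. \<exists>\<beta>m \<beta>p. has_betas g \<beta>m \<beta>p \<and> max \<beta>p \<beta>m \<in> {0..<1}}"

definition FF_pm :: "(real \<Rightarrow> real) set" where
  "FF_pm = {g \<in> FF_hat. \<exists>\<beta>m \<beta>p. has_betas g \<beta>m \<beta>p \<and> max \<beta>p \<beta>m \<ge> 1 \<and> \<beta>m \<noteq> \<beta>p}"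

definition FF_star :: "(real \<Rightarrow> real) set" where
  "FF_star = {g \<in> FF_hat. \<exists>\<beta>m \<beta>p. has_betas g \<beta>m \<beta>p \<and> max \<beta>p \<beta>m \<ge> 1 \<and> \<beta>m = \<beta>p}"

definition neutral_at :: "(real \<Rightarrow> real) \<Rightarrow> real \<Rightarrow> bool" where
  "neutral_at g p \<longleftrightarrow> (g has_real_derivative 1) (at p within {-1..1})"

definition FF_tilde :: "(real \<Rightarrow> real) set" where
  "FF_tilde = {g \<in> FF_hat. neutral_at g (-1) \<and> neutral_at g 1}"

definition diff_map :: "(real \<Rightarrow> real) \<Rightarrow> (real \<Rightarrow> real) \<Rightarrow> real \<Rightarrow> real" where
  "diff_map f g x = (if x = 0 then 0 else f x - g x)"

definition supp :: "(real \<Rightarrow> real) \<Rightarrow> real set" where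
  "supp h = {x \<in> {-1..1}. h x \<noteq> 0}"

end

theory Submission
  imports Defs
begin

text \<open>
  The numbers \<open>\<beta>\<^sup>-\<close> and \<open>\<beta>\<^sup>+\<close>, which alone separate the three subclasses, depend only on the germs
  of the map at \<open>-1\<close>, \<open>0-\<close>, \<open>0+\<close> and \<open>1\<close>. In each of these four germs an exponent is read off from
  an order of vanishing: \<open>1 + g t\<close> and \<open>1 - g (-t)\<close> have positive leading terms of order
  \<open>t powr k\<^sub>2\<close> and \<open>t powr k\<^sub>1\<close> as \<open>t\<close> tends to \<open>0\<close> from the right, and the distances by which \<open>g\<close>
  moves the points \<open>-1 + t\<close> and \<open>1 - t\<close> have positive leading terms of order \<open>t powr (1 + l\<^sub>1)\<close>
  and \<open>t powr (1 + l\<^sub>2)\<close>. In this form the exceptional cases \<open>k\<^sub>i = 1\<close> and \<open>l\<^sub>i = 0\<close> of (A1), which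
  prescribe derivatives instead of exact formulas, are no different from the generic ones.

  An order of vanishing is unique (\<open>leading_power_unique\<close>). If the closed support of \<open>f - g\<close> misses
  \<open>-1\<close>, \<open>0\<close> and \<open>1\<close>, the four germs of \<open>f\<close> and \<open>g\<close> coincide. Hence two such maps satisfying (A0)
  and (A1) have the same exponents (\<open>exponents_eq_of_support\<close>) and lie in the same subclass.
\<close>

section \<open>Order of vanishing from the right\<close>

definition leading_power :: "(real \<Rightarrow> real) \<Rightarrow> real \<Rightarrow> bool" where
  "leading_power h k \<longleftrightarrow> (\<exists>c>0. ((\<lambda>t. h t / t powr k) \<longlongrightarrow> c) (at_right 0))"

lemma leading_powerI:
  assumes "c > 0" "((\<lambda>t. h t / t powr k) \<longlongrightarrow> c) (at_right 0)"
  shows "leading_power h k"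
  using assms unfolding leading_power_def by blast

lemma leading_powerI_monomial:
  assumes "c > 0" "eventually (\<lambda>t. h t = c * t powr k) (at_right 0)"
  shows "leading_power h k"
proof (rule leading_powerI[OF assms(1)])
  have "eventually (\<lambda>t. h t / t powr k = c) (at_right 0)"
    using assms(2) eventually_at_right_less[of 0] by eventually_elim simp
  then show "((\<lambda>t. h t / t powr k) \<longlongrightarrow> c) (at_right 0)"
    by (rule tendsto_eventually)
qed

text \<open>
  If \<open>k < m\<close>, the quotient of the two normalised functions is \<open>t powr (m - k)\<close>, which tends to \<open>0\<close>,
  whereas the quotient of their limits is positive.
\<close>

lemma leading_power_not_less:
  assumes "leading_power h k" "leading_power h' m"
    and "eventually (\<lambda>t. h t = h' t) (at_right 0)"
  shows "\<not> k < m"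
proof
  assume "k < m"
  obtain c where c: "c > 0" "((\<lambda>t. h t / t powr k) \<longlongrightarrow> c) (at_right 0)"
    using assms(1) unfolding leading_power_def by blast
  obtain d where d: "d > 0" "((\<lambda>t. h' t / t powr m) \<longlongrightarrow> d) (at_right 0)"
    using assms(2) unfolding leading_power_def by blast
  have "((\<lambda>t::real. t powr (m - k)) \<longlongrightarrow> 0 powr (m - k)) (at_right 0)"
    using \<open>k < m\<close>
    by (intro tendsto_powr' tendsto_intros)
       (auto intro: eventually_mono[OF eventually_at_right_less[of 0]])
  then have "((\<lambda>t. h' t / t powr m * t powr (m - k)) \<longlongrightarrow> d * 0) (at_right 0)"
    using d(2) by (intro tendsto_mult) simp_all
  moreover have "eventually (\<lambda>t. h' t / t powr m * t powr (m - k) = h t / t powr k) (at_right 0)"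
    using assms(3) eventually_at_right_less[of 0]
    by eventually_elim (simp add: powr_diff)
  ultimately have "((\<lambda>t. h t / t powr k) \<longlongrightarrow> 0) (at_right 0)"
    by (simp add: Lim_transform_eventually)
  then have "c = 0"
    using tendsto_unique[OF trivial_limit_at_right_real c(2)] by simp
  then show False using c(1) by simp
qed

lemma leading_power_unique:
  assumes "leading_power h k" "leading_power h' m"
    and "eventually (\<lambda>t. h t = h' t) (at_right 0)"
  shows "k = m"
proof -
  have "eventually (\<lambda>t. h' t = h t) (at_right 0)"
    using assms(3) by eventually_elim simp
  then show ?thesis
    using leading_power_not_less[OF assms] leading_power_not_less[OF assms(2,1)] by force
qed

section \<open>One-sided neighbourhoods of the fixed points\<close>

lemma orientation_preserving_C2_diffeo_strict_mono_on:
  assumes "orientation_preserving_C2_diffeo f {a<..<b} B"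
  shows "strict_mono_on {a<..<b} f"
proof (rule strict_mono_onI)
  fix r s assume rs: "r \<in> {a<..<b}" "s \<in> {a<..<b}" "r < s"
  have "(f has_real_derivative deriv f x) (at x) \<and> deriv f x > 0" if "x \<in> {a<..<b}" for x
  proof -
    obtain f' f'' where "has_C2_derivs f f' f'' {a<..<b}"
      using assms unfolding orientation_preserving_C2_diffeo_def C2_on_def by blast
    then have "(f has_real_derivative f' x) (at x within {a<..<b})"
      using that by (simp add: has_C2_derivs_def)
    then have "(f has_real_derivative f' x) (at x)"
      by (simp only: at_within_open[OF that open_greaterThanLessThan])
    moreover from this have "f' x = deriv f x" by (rule DERIV_imp_deriv[symmetric])
    moreover have "deriv f x > 0"
      using assms that by (simp add: orientation_preserving_C2_diffeo_def)
    ultimately show ?thesis by simp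
  qed
  note deriv = this
  show "f r < f s"
  proof (rule DERIV_pos_imp_increasing[OF rs(3)])
    fix x assume "r \<le> x" "x \<le> s"
    then have "x \<in> {a<..<b}" using rs by auto
    then show "\<exists>y. (f has_real_derivative y) (at x) \<and> y > 0" using deriv by blast
  qed
qed

text \<open>
  The formulas of (A1) at \<open>-1\<close> and \<open>1\<close> hold on images of one-sided neighbourhoods of \<open>0\<close>. Such an
  image is a one-sided neighbourhood of the fixed point since the branch is increasing and onto: every
  value beyond that at the midpoint of the neighbourhood is taken between the midpoint and \<open>0\<close>.
\<close>

lemma U_neg1_nhd:
  assumes "A0 g" "0 < \<iota>" "\<iota> \<le> 1"
  obtains e where "0 < e" "{-1..-1 + e} \<subseteq> U_neg1 g \<iota>"
proof -
  have diffeo: "orientation_preserving_C2_diffeo g {0<..<1} {-1<..<1}"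
    using assms(1) unfolding A0_def by blast
  then have bij: "bij_betw g {0<..<1} {-1<..<1}"
    unfolding orientation_preserving_C2_diffeo_def by blast
  have mono: "strict_mono_on {0<..<1} g"
    using diffeo by (rule orientation_preserving_C2_diffeo_strict_mono_on)
  have mid: "\<iota> / 2 \<in> {0<..<1}" using assms by auto
  then have gmid: "g (\<iota> / 2) \<in> {-1<..<1}" using bij_betwE[OF bij] by blast
  define e where "e = (g (\<iota> / 2) + 1) / 2"
  have "0 < e" using gmid by (simp add: e_def)
  moreover have "y \<in> U_neg1 g \<iota>" if y: "y \<in> {-1..-1 + e}" for y
  proof (cases "y = -1")
    case True
    then show ?thesis
      using assms(2) unfolding U_neg1_def U0_plus_def branch_plus_def by force
  next
    case False
    have less: "y < g (\<iota> / 2)" using y gmid by (simp add: e_def field_simps)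
    then have "y \<in> {-1<..<1}" using y gmid False by auto
    then obtain x where x: "x \<in> {0<..<1}" "y = g x"
      using bij unfolding bij_betw_def by blast
    have "x < \<iota> / 2" using less x(2) strict_mono_on_less[OF mono x(1) mid] by simp
    then have "x \<in> U0_plus \<iota>" "branch_plus g x = y"
      using x assms(2) unfolding U0_plus_def branch_plus_def by auto
    then show ?thesis unfolding U_neg1_def by blast
  qed
  ultimately show ?thesis using that by blast
qed

lemma U_pos1_nhd:
  assumes "A0 g" "0 < \<iota>" "\<iota> \<le> 1"
  obtains e where "0 < e" "{1 - e..1} \<subseteq> U_pos1 g \<iota>"
proof -
  have diffeo: "orientation_preserving_C2_diffeo g {-1<..<0} {-1<..<1}"
    using assms(1) unfolding A0_def by blast
  then have bij: "bij_betw g {-1<..<0} {-1<..<1}"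
    unfolding orientation_preserving_C2_diffeo_def by blast
  have mono: "strict_mono_on {-1<..<0} g"
    using diffeo by (rule orientation_preserving_C2_diffeo_strict_mono_on)
  have mid: "-\<iota> / 2 \<in> {-1<..<0}" using assms by auto
  then have gmid: "g (-\<iota> / 2) \<in> {-1<..<1}" using bij_betwE[OF bij] by blast
  define e where "e = (1 - g (-\<iota> / 2)) / 2"
  have "0 < e" using gmid by (simp add: e_def)
  moreover have "y \<in> U_pos1 g \<iota>" if y: "y \<in> {1 - e..1}" for y
  proof (cases "y = 1")
    case True
    then show ?thesis
      using assms(2) unfolding U_pos1_def U0_minus_def branch_minus_def by force
  next
    case False
    have less: "g (-\<iota> / 2) < y"
      using y gmid unfolding e_def atLeastAtMost_iff greaterThanLessThan_iff by argo
    then have "y \<in> {-1<..<1}" using y gmid False by auto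
    then obtain x where x: "x \<in> {-1<..<0}" "y = g x"
      using bij unfolding bij_betw_def by blast
    have "-\<iota> / 2 < x" using less x(2) strict_mono_on_less[OF mono mid x(1)] by simp
    then have "x \<in> U0_minus \<iota>" "branch_minus g x = y"
      using x assms(2) unfolding U0_minus_def branch_minus_def by auto
    then show ?thesis unfolding U_pos1_def by blast
  qed
  ultimately show ?thesis using that by blast
qed

section \<open>The exponents as orders of vanishing\<close>

lemma tendsto_difference_quotient_right:
  fixes f :: "real \<Rightarrow> real"
  assumes "(f has_real_derivative D) (at_right p)"
  shows "((\<lambda>t. (f (p + t) - f p) / t) \<longlongrightarrow> D) (at_right 0)"
  using assms filterlim_at_right_to_0[of "\<lambda>x. (f x - f p) / (x - p)" "nhds D" p]
  by (simp add: has_field_derivative_iff add.commute)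

lemma tendsto_difference_quotient_left:
  fixes f :: "real \<Rightarrow> real"
  assumes "(f has_real_derivative D) (at_left p)"
  shows "((\<lambda>t. (f p - f (p - t)) / t) \<longlongrightarrow> D) (at_right 0)"
proof -
  have "((\<lambda>x. (f x - f p) / (x - p)) \<longlongrightarrow> D) (at_left p)"
    using assms by (simp add: has_field_derivative_iff)
  then have "((\<lambda>t. (f (- t) - f p) / (- t - p)) \<longlongrightarrow> D) (at_right (- p))"
    by (subst (asm) filterlim_at_left_to_right)
  then have "((\<lambda>t. (f (p - t) - f p) / (- t)) \<longlongrightarrow> D) (at_right 0)"
    by (subst (asm) filterlim_at_right_to_0) simp
  moreover have "(f (p - t) - f p) / (- t) = (f p - f (p - t)) / t" for t
    by (cases "t = 0") (auto simp: field_simps)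
  ultimately show ?thesis by simp
qed

text \<open>
  The one-sided derivative \<open>a\<^sub>2\<close> prescribed for \<open>k\<^sub>2 = 1\<close> is the limit of \<open>(1 + g t) / t\<close>, since the
  extended branch has the value \<open>-1\<close> at \<open>0\<close>. So \<open>a\<^sub>2\<close> is the leading coefficient in both cases.
\<close>

lemma leading_power_zero_plus:
  assumes "A1 g l\<^sub>1 l\<^sub>2 \<iota> k\<^sub>1 k\<^sub>2 a\<^sub>1 a\<^sub>2 b\<^sub>1 b\<^sub>2"
  shows "leading_power (\<lambda>t. 1 + g t) k\<^sub>2"
proof -
  have pos: "0 < \<iota>" "0 < a\<^sub>2" using assms unfolding A1_def by auto
  show ?thesis
  proof (cases "k\<^sub>2 = 1")
    case True
    then have "(branch_plus g has_real_derivative a\<^sub>2) (at_right 0)"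
      using assms unfolding A1_def by simp
    then have lim: "((\<lambda>t. (branch_plus g (0 + t) - branch_plus g 0) / t) \<longlongrightarrow> a\<^sub>2) (at_right 0)"
      by (rule tendsto_difference_quotient_right)
    have "eventually (\<lambda>t. (branch_plus g (0 + t) - branch_plus g 0) / t = (1 + g t) / t powr k\<^sub>2)
        (at_right 0)"
      using eventually_at_right_less[of 0]
      by eventually_elim (simp add: True branch_plus_def add.commute)
    with lim have "((\<lambda>t. (1 + g t) / t powr k\<^sub>2) \<longlongrightarrow> a\<^sub>2) (at_right 0)"
      by (rule Lim_transform_eventually)
    then show ?thesis using pos(2) by (intro leading_powerI)
  next
    case False
    then have formula: "\<forall>x\<in>U0_plus \<iota>. branch_plus g x = -1 + a\<^sub>2 * x powr k\<^sub>2"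
      using assms unfolding A1_def by simp
    have "eventually (\<lambda>t. t \<in> {0<..<\<iota>}) (at_right 0)"
      using pos(1) by (rule eventually_at_right_real)
    then have "eventually (\<lambda>t. 1 + g t = a\<^sub>2 * t powr k\<^sub>2) (at_right 0)"
    proof eventually_elim
      case (elim t)
      then have "branch_plus g t = -1 + a\<^sub>2 * t powr k\<^sub>2"
        using formula by (simp add: U0_plus_def)
      then show ?case using elim by (simp add: branch_plus_def)
    qed
    then show ?thesis using pos(2) by (intro leading_powerI_monomial)
  qed
qed

lemma leading_power_zero_minus:
  assumes "A1 g l\<^sub>1 l\<^sub>2 \<iota> k\<^sub>1 k\<^sub>2 a\<^sub>1 a\<^sub>2 b\<^sub>1 b\<^sub>2"
  shows "leading_power (\<lambda>t. 1 - g (- t)) k\<^sub>1"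
proof -
  have pos: "0 < \<iota>" "0 < a\<^sub>1" using assms unfolding A1_def by auto
  show ?thesis
  proof (cases "k\<^sub>1 = 1")
    case True
    then have "(branch_minus g has_real_derivative a\<^sub>1) (at_left 0)"
      using assms unfolding A1_def by simp
    then have lim: "((\<lambda>t. (branch_minus g 0 - branch_minus g (0 - t)) / t) \<longlongrightarrow> a\<^sub>1) (at_right 0)"
      by (rule tendsto_difference_quotient_left)
    have "eventually (\<lambda>t. (branch_minus g 0 - branch_minus g (0 - t)) / t
        = (1 - g (- t)) / t powr k\<^sub>1) (at_right 0)"
      using eventually_at_right_less[of 0]
      by eventually_elim (simp add: True branch_minus_def)
    with lim have "((\<lambda>t. (1 - g (- t)) / t powr k\<^sub>1) \<longlongrightarrow> a\<^sub>1) (at_right 0)"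
      by (rule Lim_transform_eventually)
    then show ?thesis using pos(2) by (intro leading_powerI)
  next
    case False
    then have formula: "\<forall>x\<in>U0_minus \<iota>. branch_minus g x = 1 - a\<^sub>1 * \<bar>x\<bar> powr k\<^sub>1"
      using assms unfolding A1_def by simp
    have "eventually (\<lambda>t. t \<in> {0<..<\<iota>}) (at_right 0)"
      using pos(1) by (rule eventually_at_right_real)
    then have "eventually (\<lambda>t. 1 - g (- t) = a\<^sub>1 * t powr k\<^sub>1) (at_right 0)"
    proof eventually_elim
      case (elim t)
      then have "branch_minus g (- t) = 1 - a\<^sub>1 * \<bar>- t\<bar> powr k\<^sub>1"
        using formula unfolding U0_minus_def by force
      then show ?case using elim by (simp add: branch_minus_def)
    qed
    then show ?thesis using pos(2) by (intro leading_powerI_monomial)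
  qed
qed

text \<open>
  When \<open>l\<^sub>1 = 0\<close>, the correction \<open>\<eta>\<close> is \<open>o(t)\<close> because its derivative at \<open>-1\<close> vanishes; the leading
  term is then \<open>b\<^sub>1 * t\<close>, which is what \<open>1 + l\<^sub>1 = 1\<close> says.
\<close>

lemma leading_power_neg1:
  assumes "A0 g" "A1 g l\<^sub>1 l\<^sub>2 \<iota> k\<^sub>1 k\<^sub>2 a\<^sub>1 a\<^sub>2 b\<^sub>1 b\<^sub>2"
  shows "leading_power (\<lambda>t. g (-1 + t) - (-1 + t)) (1 + l\<^sub>1)"
proof -
  have pos: "0 < \<iota>" "\<iota> \<le> 1" "0 < b\<^sub>1" "0 \<le> l\<^sub>1" using assms(2) unfolding A1_def by auto
  obtain e where e: "0 < e" "{-1..-1 + e} \<subseteq> U_neg1 g \<iota>"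
    using U_neg1_nhd[OF assms(1) pos(1,2)] .
  have ev: "eventually (\<lambda>t. 0 < t \<and> -1 + t \<in> U_neg1 g \<iota>) (at_right 0)"
    using eventually_at_right_real[OF e(1)] by eventually_elim (use e in auto)
  show ?thesis
  proof (cases "l\<^sub>1 = 0")
    case True
    obtain \<eta> \<eta>' \<eta>'' where \<eta>: "has_C2_derivs \<eta> \<eta>' \<eta>'' (U_neg1 g \<iota>)" "\<eta> (-1) = 0" "\<eta>' (-1) = 0"
      and formula: "\<And>x. x \<in> U_neg1 g \<iota> \<Longrightarrow> g x = -1 + (1 + b\<^sub>1) * (x + 1) + \<eta> x"
      using assms(2) True unfolding A1_def by auto
    have "-1 \<in> U_neg1 g \<iota>" using e by force
    then have "(\<eta> has_real_derivative 0) (at (-1) within U_neg1 g \<iota>)"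
      using \<eta> unfolding has_C2_derivs_def by metis
    then have "(\<eta> has_real_derivative 0) (at (-1) within {-1..-1 + e})"
      using e(2) by (rule has_field_derivative_subset)
    then have "(\<eta> has_real_derivative 0) (at_right (-1))"
      using e(1) by (simp add: at_within_Icc_at_right)
    then have "((\<lambda>t. (\<eta> (-1 + t) - \<eta> (-1)) / t) \<longlongrightarrow> 0) (at_right 0)"
      by (rule tendsto_difference_quotient_right)
    then have lim: "((\<lambda>t. b\<^sub>1 + (\<eta> (-1 + t) - \<eta> (-1)) / t) \<longlongrightarrow> b\<^sub>1 + 0) (at_right 0)"
      by (intro tendsto_add tendsto_const)
    have "eventually (\<lambda>t. b\<^sub>1 + (\<eta> (-1 + t) - \<eta> (-1)) / t
        = (g (-1 + t) - (-1 + t)) / t powr (1 + l\<^sub>1)) (at_right 0)"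
      using ev
    proof eventually_elim
      case (elim t)
      then have "g (-1 + t) = -1 + (1 + b\<^sub>1) * t + \<eta> (-1 + t)"
        using formula[of "-1 + t"] by simp
      then show ?case using elim \<eta>(2) True by (simp add: field_simps)
    qed
    with lim have "((\<lambda>t. (g (-1 + t) - (-1 + t)) / t powr (1 + l\<^sub>1)) \<longlongrightarrow> b\<^sub>1 + 0) (at_right 0)"
      by (rule Lim_transform_eventually)
    then show ?thesis using pos(3) by (intro leading_powerI[of b\<^sub>1]) simp_all
  next
    case False
    then have formula: "\<forall>x\<in>U_neg1 g \<iota>. g x = x + b\<^sub>1 * (1 + x) powr (1 + l\<^sub>1)"
      using assms(2) pos(4) unfolding A1_def by simp
    have "eventually (\<lambda>t. g (-1 + t) - (-1 + t) = b\<^sub>1 * t powr (1 + l\<^sub>1)) (at_right 0)"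
      using ev by eventually_elim (simp add: formula)
    then show ?thesis using pos(3) by (intro leading_powerI_monomial)
  qed
qed

lemma leading_power_pos1:
  assumes "A0 g" "A1 g l\<^sub>1 l\<^sub>2 \<iota> k\<^sub>1 k\<^sub>2 a\<^sub>1 a\<^sub>2 b\<^sub>1 b\<^sub>2"
  shows "leading_power (\<lambda>t. (1 - t) - g (1 - t)) (1 + l\<^sub>2)"
proof -
  have pos: "0 < \<iota>" "\<iota> \<le> 1" "0 < b\<^sub>2" "0 \<le> l\<^sub>2" using assms(2) unfolding A1_def by auto
  obtain e where e: "0 < e" "{1 - e..1} \<subseteq> U_pos1 g \<iota>"
    using U_pos1_nhd[OF assms(1) pos(1,2)] .
  have ev: "eventually (\<lambda>t. 0 < t \<and> 1 - t \<in> U_pos1 g \<iota>) (at_right 0)"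
    using eventually_at_right_real[OF e(1)] by eventually_elim (use e in auto)
  show ?thesis
  proof (cases "l\<^sub>2 = 0")
    case True
    obtain \<eta> \<eta>' \<eta>'' where \<eta>: "has_C2_derivs \<eta> \<eta>' \<eta>'' (U_pos1 g \<iota>)" "\<eta> 1 = 0" "\<eta>' 1 = 0"
      and formula: "\<And>x. x \<in> U_pos1 g \<iota> \<Longrightarrow> g x = 1 + (1 + b\<^sub>2) * (x - 1) + \<eta> x"
      using assms(2) True unfolding A1_def by auto
    have "1 \<in> U_pos1 g \<iota>" using e by force
    then have "(\<eta> has_real_derivative 0) (at 1 within U_pos1 g \<iota>)"
      using \<eta> unfolding has_C2_derivs_def by metis
    then have "(\<eta> has_real_derivative 0) (at 1 within {1 - e..1})"
      using e(2) by (rule has_field_derivative_subset)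
    then have "(\<eta> has_real_derivative 0) (at_left 1)"
      using e(1) by (simp add: at_within_Icc_at_left)
    then have "((\<lambda>t. (\<eta> 1 - \<eta> (1 - t)) / t) \<longlongrightarrow> 0) (at_right 0)"
      by (rule tendsto_difference_quotient_left)
    then have lim: "((\<lambda>t. b\<^sub>2 + (\<eta> 1 - \<eta> (1 - t)) / t) \<longlongrightarrow> b\<^sub>2 + 0) (at_right 0)"
      by (intro tendsto_add tendsto_const)
    have "eventually (\<lambda>t. b\<^sub>2 + (\<eta> 1 - \<eta> (1 - t)) / t
        = ((1 - t) - g (1 - t)) / t powr (1 + l\<^sub>2)) (at_right 0)"
      using ev
    proof eventually_elim
      case (elim t)
      then have "g (1 - t) = 1 - (1 + b\<^sub>2) * t + \<eta> (1 - t)"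
        using formula[of "1 - t"] by simp
      then show ?case using elim \<eta>(2) True by (simp add: field_simps)
    qed
    with lim have "((\<lambda>t. ((1 - t) - g (1 - t)) / t powr (1 + l\<^sub>2)) \<longlongrightarrow> b\<^sub>2 + 0) (at_right 0)"
      by (rule Lim_transform_eventually)
    then show ?thesis using pos(3) by (intro leading_powerI[of b\<^sub>2]) simp_all
  next
    case False
    then have formula: "\<forall>x\<in>U_pos1 g \<iota>. g x = x - b\<^sub>2 * (1 - x) powr (1 + l\<^sub>2)"
      using assms(2) pos(4) unfolding A1_def by simp
    have "eventually (\<lambda>t. (1 - t) - g (1 - t) = b\<^sub>2 * t powr (1 + l\<^sub>2)) (at_right 0)"
      using ev by eventually_elim (simp add: formula)
    then show ?thesis using pos(3) by (intro leading_powerI_monomial)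
  qed
qed

section \<open>Invariance under perturbations away from the singular and fixed points\<close>

lemma eventually_eq_off_support:
  assumes "closure (supp (diff_map f g)) \<subseteq> {-1<..<0} \<union> {0<..<1}" "p \<in> {-1, 0, 1}"
  shows "eventually (\<lambda>x. x \<in> {-1..1} - {0} \<longrightarrow> f x = g x) (nhds p)"
proof -
  have "p \<in> - closure (supp (diff_map f g))" using assms by auto
  then have "eventually (\<lambda>x. x \<in> - closure (supp (diff_map f g))) (nhds p)"
    by (intro eventually_nhds_in_open) auto
  then show ?thesis
  proof eventually_elim
    case (elim x)
    then have "x \<notin> supp (diff_map f g)" using closure_subset by blast
    then show ?case by (auto simp: supp_def diff_map_def)
  qed
qed

text \<open>
  The path \<open>\<phi>\<close> approaches a point of the complement of the closed support, an open set. The paths of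
  interest are \<open>t\<close>, \<open>- t\<close>, \<open>-1 + t\<close> and \<open>1 - t\<close>, one for each germ.
\<close>

lemma eventually_eq_along:
  assumes "closure (supp (diff_map f g)) \<subseteq> {-1<..<0} \<union> {0<..<1}" "p \<in> {-1, 0, 1}"
    and "(\<phi> \<longlongrightarrow> p) (at_right 0)" "\<And>t. 0 < t \<Longrightarrow> t < 1 \<Longrightarrow> \<phi> t \<in> {-1..1} - {0}"
  shows "eventually (\<lambda>t. f (\<phi> t) = g (\<phi> t)) (at_right (0::real))"
proof -
  have "eventually (\<lambda>t. \<phi> t \<in> {-1..1} - {0} \<longrightarrow> f (\<phi> t) = g (\<phi> t)) (at_right 0)"
    using eventually_eq_off_support[OF assms(1,2)] assms(3)
    by (rule eventually_compose_filterlim)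
  moreover have "eventually (\<lambda>t::real. t \<in> {0<..<1}) (at_right 0)"
    by (rule eventually_at_right_real) simp
  ultimately show ?thesis
    by eventually_elim (use assms(4) in auto)
qed

lemma exponents_eq_of_support:
  assumes supp: "closure (supp (diff_map f g)) \<subseteq> {-1<..<0} \<union> {0<..<1}"
    and "FF_hat_exponents f l\<^sub>1 l\<^sub>2 k\<^sub>1 k\<^sub>2" "FF_hat_exponents g l\<^sub>1' l\<^sub>2' k\<^sub>1' k\<^sub>2'"
  shows "l\<^sub>1 = l\<^sub>1' \<and> l\<^sub>2 = l\<^sub>2' \<and> k\<^sub>1 = k\<^sub>1' \<and> k\<^sub>2 = k\<^sub>2'"
proof -
  obtain \<iota> a\<^sub>1 a\<^sub>2 b\<^sub>1 b\<^sub>2 where f: "A0 f" "A1 f l\<^sub>1 l\<^sub>2 \<iota> k\<^sub>1 k\<^sub>2 a\<^sub>1 a\<^sub>2 b\<^sub>1 b\<^sub>2"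
    using assms(2) unfolding FF_hat_exponents_def by blast
  obtain \<iota>' a\<^sub>1' a\<^sub>2' b\<^sub>1' b\<^sub>2' where g: "A0 g" "A1 g l\<^sub>1' l\<^sub>2' \<iota>' k\<^sub>1' k\<^sub>2' a\<^sub>1' a\<^sub>2' b\<^sub>1' b\<^sub>2'"
    using assms(3) unfolding FF_hat_exponents_def by blast
  have "eventually (\<lambda>t. f t = g t) (at_right 0)"
    by (rule eventually_eq_along[OF supp, of 0]) (auto intro!: tendsto_eq_intros)
  then have "eventually (\<lambda>t. 1 + f t = 1 + g t) (at_right 0)"
    by eventually_elim simp
  then have "k\<^sub>2 = k\<^sub>2'"
    by (rule leading_power_unique[OF leading_power_zero_plus[OF f(2)] leading_power_zero_plus[OF g(2)]])
  moreover
  have "eventually (\<lambda>t. f (- t) = g (- t)) (at_right 0)"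
    by (rule eventually_eq_along[OF supp, of 0]) (auto intro!: tendsto_eq_intros)
  then have "eventually (\<lambda>t. 1 - f (- t) = 1 - g (- t)) (at_right 0)"
    by eventually_elim simp
  then have "k\<^sub>1 = k\<^sub>1'"
    by (rule leading_power_unique[OF leading_power_zero_minus[OF f(2)] leading_power_zero_minus[OF g(2)]])
  moreover
  have "eventually (\<lambda>t. f (-1 + t) = g (-1 + t)) (at_right 0)"
    by (rule eventually_eq_along[OF supp, of "-1"]) (auto intro!: tendsto_eq_intros)
  then have "eventually (\<lambda>t. f (-1 + t) - (-1 + t) = g (-1 + t) - (-1 + t)) (at_right 0)"
    by eventually_elim simp
  then have "1 + l\<^sub>1 = 1 + l\<^sub>1'"
    by (rule leading_power_unique[OF leading_power_neg1[OF f] leading_power_neg1[OF g]])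
  moreover
  have "eventually (\<lambda>t. f (1 - t) = g (1 - t)) (at_right 0)"
    by (rule eventually_eq_along[OF supp, of 1]) (auto intro!: tendsto_eq_intros)
  then have "eventually (\<lambda>t. (1 - t) - f (1 - t) = (1 - t) - g (1 - t)) (at_right 0)"
    by eventually_elim simp
  then have "1 + l\<^sub>2 = 1 + l\<^sub>2'"
    by (rule leading_power_unique[OF leading_power_pos1[OF f] leading_power_pos1[OF g]])
  ultimately show ?thesis by simp
qed

theorem theorem4:
  fixes f g :: "real \<Rightarrow> real"
  assumes "g \<in> FF_tilde"
    and "closure (supp (diff_map f g)) \<subseteq> {-1<..<0} \<union> {0<..<1}"
  shows "(f \<in> FF_star \<longrightarrow> g \<in> FF_star) \<and> (f \<in> FF \<longrightarrow> g \<in> FF) \<and> (f \<in> FF_pm \<longrightarrow> g \<in> FF_pm)"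
proof -
  have hat: "g \<in> FF_hat" using assms(1) unfolding FF_tilde_def by blast
  then obtain l\<^sub>1 l\<^sub>2 k\<^sub>1 k\<^sub>2 where g: "FF_hat_exponents g l\<^sub>1 l\<^sub>2 k\<^sub>1 k\<^sub>2"
    unfolding FF_hat_def by blast
  have "has_betas g \<beta>m \<beta>p" if "has_betas f \<beta>m \<beta>p" for \<beta>m \<beta>p
    using that g exponents_eq_of_support[OF assms(2) _ g] unfolding has_betas_def by metis
  then show ?thesis
    using hat unfolding FF_star_def FF_def FF_pm_def by blast
qed

end
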